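(* Let $H$ be a graph with vertex set $\{v_1,\dots,v_k\}$, and let $G_1,\dots,G_k$ be arbitrary graphs. Let $G_i$ have $n_i$ vertices, adjacency matrix $A_i$ and degree matrix $D_i$. Let $G=\bigvee_H\{G_1,\dots,G_k\}$ be the $H$-join. Let $t\in\mathbb{R}$, $M(G)=A(G)-tD(G)$ and $M_i=A_i-tD_i$. Let $\phi_i(\lambda)=\det(\lambda I_{n_i}-M_i)$ and $\Gamma_i(\lambda)=\mathbf{1}_{n_i}^t(\lambda I_{n_i}-M_i)^{-1}\mathbf{1}_{n_i}$. Let $w_i=\sum_{v_l\in N_H(v_i)}n_l$, and let $\rho_{ij}=1$ if $v_iv_j\in E(H)$ and $0$ otherwise. (i) The characteristic polynomial of $M(G)$ is $$\phi_{M(G)}(\lambda)=\prod_{i=1}^k\phi_i(\lambda+tw_i)\Gamma_i(\lambda+tw_i)\cdot\det\widetilde M,$$ where $\widetilde M$ is the $k\times k$ matrix with diagonal entries $1/\Gamma_i(\lambda+tw_i)$ and off-diagonal entries $-\rho_{ij}$. (ii) Let $\theta^{(i)}_1,\dots,\theta^{(i)}_{m_i}$ be the distinct main eigenvalues of $M_i$. Set $g_i(\lambda)=\prod_{j=1}^{m_i}(\lambda+tw_i-\theta^{(i)}_j)$ and $f_i(\lambda)=g_i(\lambda)\Gamma_i(\lambda+tw_i)$. Let $\Phi(\lambda)$ be the determinant of the $k\times k$ matrix with diagonal entries $g_i(\lambda)$ and off-diagonal $(i,j)$ entries $-\rho_{ij}f_i(\lambda)$. Then, as a multiset, the spectrum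 of $M(G)$ consists of: - $\mu-tw_i$ for every eigenvalue $\mu$ of $M_i$ that is not a main eigenvalue of $M_i$, with the multiplicity of $\mu$ in $M_i$; - $\mu-tw_i$ for every main eigenvalue $\mu$ of $M_i$, with multiplicity one less than that of $\mu$ in $M_i$; - the roots of $\Phi(\lambda)$.
   Context: All graphs are finite and simple. The $H$-join $\bigvee_H\{G_1,\dots,G_k\}$ has vertex set $\bigcup_iV(G_i)$ (disjoint union). Its edges are those of each $G_i$ together with all edges between $V(G_i)$ and $V(G_j)$ whenever $v_iv_j\in E(H)$. $D(\cdot)$ is the degree matrix and $\mathbf{1}_m$ the all-ones vector. An eigenvalue of a real symmetric matrix is main if its eigenspace is not orthogonal to the all-ones vector. *)

theory Defs
  imports
    "Graph_Theory.Pair_Digraph"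
    "Jordan_Normal_Form.Char_Poly"
    "HOL-Computational_Algebra.Computational_Algebra"
begin

text \<open>
  A finite simple graph is a \<open>pair_graph\<close>: a finite vertex set \<open>pverts\<close> and a symmetric,
  loop-free set \<open>parcs\<close> of pairs of vertices; an edge \<open>uv\<close> is represented by the two arcs
  \<open>(u, v)\<close> and \<open>(v, u)\<close>.

  The summands of an \<open>H\<close>-join are a family \<open>G\<close> indexed by the vertices of \<open>H\<close>; the disjoint
  union of their vertex sets is a dependent sum.
\<close>

definition hjoin ::
  "'h pair_pre_digraph \<Rightarrow> ('h \<Rightarrow> 'a pair_pre_digraph) \<Rightarrow> ('h \<times> 'a) pair_pre_digraph" where
  "hjoin H G =
     \<lparr> pverts = (SIGMA x:pverts H. pverts (G x)),
       parcs = {((x, u), (x, v)) | x u v. x \<in> pverts H \<and> (u, v) \<in> parcs (G x)}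
             \<union> {((x, u), (y, v)) | x u y v.
                  (x, y) \<in> parcs H \<and> u \<in> pverts (G x) \<and> v \<in> pverts (G y)} \<rparr>"

lemma pair_graphD:
  assumes K: "pair_graph K" and e: "(u, v) \<in> parcs K"
  shows "u \<in> pverts K" "v \<in> pverts K" "(v, u) \<in> parcs K" "u \<noteq> v"
proof -
  interpret K: pair_graph K by (rule K)
  show "u \<in> pverts K" "v \<in> pverts K" "u \<noteq> v"
    using K.in_arcsD1[OF e] K.in_arcsD2[OF e] K.pair_no_loops[OF e] by simp_all
  show "(v, u) \<in> parcs K"
    using K.pair_sym_arcs e unfolding symmetric_def with_proj_simps by (rule symD)
qed

lemma pair_graph_hjoin:
  assumes H: "pair_graph H" and G: "\<And>x. x \<in> pverts H \<Longrightarrow> pair_graph (G x)"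
  shows "pair_graph (hjoin H G)"
proof -
  interpret H: pair_graph H by (rule H)
  note Hwf = pair_graphD[OF H] and Gwf = pair_graphD[OF G]
  have fin: "finite (pverts (hjoin H G))"
    using H.pair_finite_verts G[THEN pair_graph.axioms(1)]
    by (auto simp: hjoin_def pair_digraph_def pair_fin_digraph_def pair_fin_digraph_axioms_def)
  have wf: "e \<in> parcs (hjoin H G) \<Longrightarrow> fst e \<in> pverts (hjoin H G) \<and> snd e \<in> pverts (hjoin H G)" for e
    using Gwf Hwf by (auto simp: hjoin_def)
  show ?thesis
  proof unfold_locales
    show "finite (parcs (hjoin H G))"
      using wf finite_subset[OF _ finite_cartesian_product[OF fin fin]]
      by (metis mem_Times_iff subsetI)
    show "symmetric (with_proj (hjoin H G))"
      unfolding symmetric_def with_proj_simps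
      by (rule symI) (use Gwf Hwf in \<open>auto simp: hjoin_def\<close>)
    show "fst e \<noteq> snd e" if "e \<in> parcs (hjoin H G)" for e
      using that Gwf Hwf by (auto simp: hjoin_def)
  qed (use wf fin in auto)
qed

text \<open>Graph matrices are taken with respect to an enumeration \<open>vs\<close> of the vertices.\<close>

definition enumerates :: "'a list \<Rightarrow> 'a set \<Rightarrow> bool" where
  "enumerates vs V \<longleftrightarrow> distinct vs \<and> set vs = V"

definition adjacency_matrix :: "'a pair_pre_digraph \<Rightarrow> 'a list \<Rightarrow> real mat" where
  "adjacency_matrix G vs =
     mat (length vs) (length vs) (\<lambda>(i, j). if (vs ! i, vs ! j) \<in> parcs G then 1 else 0)"

text \<open>In a \<open>pair_graph\<close> every edge at \<open>v\<close> contributes exactly one arc leaving \<open>v\<close>, so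
  \<open>out_degree\<close> is the degree.\<close>

definition degree_matrix :: "'a pair_pre_digraph \<Rightarrow> 'a list \<Rightarrow> real mat" where
  "degree_matrix G vs =
     mat (length vs) (length vs)
       (\<lambda>(i, j). if i = j then real (out_degree (with_proj G) (vs ! i)) else 0)"

definition adj_deg_matrix :: "real \<Rightarrow> 'a pair_pre_digraph \<Rightarrow> 'a list \<Rightarrow> real mat" where
  "adj_deg_matrix t G vs = adjacency_matrix G vs - t \<cdot>\<^sub>m degree_matrix G vs"

definition ones_vec :: "nat \<Rightarrow> 'a :: one vec" where
  "ones_vec n = vec n (\<lambda>_. 1)"

definition eigenspace :: "real mat \<Rightarrow> real \<Rightarrow> real vec set" where
  "eigenspace M \<mu> = {v \<in> carrier_vec (dim_row M). M *\<^sub>v v = \<mu> \<cdot>\<^sub>v v}"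

definition main_eigenvalue :: "real mat \<Rightarrow> real \<Rightarrow> bool" where
  "main_eigenvalue M \<mu> \<longleftrightarrow>
     eigenvalue M \<mu> \<and> \<not> (\<forall>v \<in> eigenspace M \<mu>. v \<bullet> ones_vec (dim_row M) = 0)"

definition eig_mult :: "real mat \<Rightarrow> real \<Rightarrow> nat" where
  "eig_mult M \<mu> = order \<mu> (char_poly M)"

text \<open>All complex eigenvalues, repeated according to multiplicity.\<close>

definition spectrum_mset :: "real mat \<Rightarrow> complex multiset" where
  "spectrum_mset M = proots (char_poly (map_mat complex_of_real M))"

text \<open>
  \<open>\<Gamma>(\<xi>) = 1\<^sup>t (\<xi>I - M)\<^sup>-\<^sup>1 1\<close> is a rational function, so it is evaluated at elements \<open>\<xi>\<close> of the
  field \<open>\<real>(\<lambda>)\<close>, here \<open>real poly fract\<close>, whose indeterminate \<open>\<lambda>\<close> is \<open>to_fract [:0, 1:]\<close>. For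
  \<open>\<xi> = \<lambda> + c\<close> with a real constant \<open>c\<close> the matrix \<open>\<xi>I - M\<close> is always invertible over \<open>\<real>(\<lambda>)\<close>,
  its determinant being a monic polynomial, so the inverse below is a genuine one.
\<close>

definition main_function :: "real mat \<Rightarrow> real poly fract \<Rightarrow> real poly fract" where
  "main_function M \<xi> =
     (let n = dim_row M;
          N = \<xi> \<cdot>\<^sub>m 1\<^sub>m n - map_mat (\<lambda>c. to_fract [:c:]) M
      in ones_vec n \<bullet> (the (mat_inverse N) *\<^sub>v ones_vec n))"

end

theory Submission
  imports
    Defs
    "Jordan_Normal_Form.Jordan_Normal_Form_Existence"
    "Jordan_Normal_Form.Jordan_Normal_Form_Uniqueness"
begin

text \<open>
  In block form, \<open>\<lambda>I - M(G) = B - E R E\<^sup>t\<close>, where \<open>B\<close> is block diagonal with blocks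
  \<open>(\<lambda> + t w\<^sub>i) I - M\<^sub>i\<close>, \<open>R = (\<rho>\<^sub>i\<^sub>j)\<close>, and \<open>E\<close> is the vertex-to-part incidence matrix. Sylvester's
  identity \<open>det (I - X Y) = det (I - Y X)\<close> turns the determinant into
  \<open>det B \<cdot> det (I - E\<^sup>t B\<^sup>-\<^sup>1 E R)\<close>, and \<open>E\<^sup>t B\<^sup>-\<^sup>1 E\<close> is the diagonal matrix of the
  \<open>\<Gamma>\<^sub>i(\<lambda> + t w\<^sub>i)\<close>; scaling rows by \<open>\<Gamma>\<^sub>i\<close> gives (i), scaling them by \<open>g\<^sub>i\<close> gives (ii). For (ii) one
  also needs \<open>f\<^sub>i = g\<^sub>i \<Gamma>\<^sub>i\<close> to be a polynomial: diagonalizing \<open>M\<^sub>i\<close> writes \<open>\<Gamma>\<^sub>i\<close> as a sum of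
  simple fractions whose numerators vanish unless the pole is a main eigenvalue.
\<close>

section \<open>Determinants of matrices indexed by lists\<close>

text \<open>Indexing by vertices instead of positions lets sums run over vertex sets, and lets the
  matrix of a join be compared entry by entry with those of its parts, whatever the
  enumeration.\<close>

definition fun_mat :: "'r list \<Rightarrow> 'c list \<Rightarrow> ('r \<Rightarrow> 'c \<Rightarrow> 'b) \<Rightarrow> 'b mat" where
  "fun_mat rs cs F = mat (length rs) (length cs) (\<lambda>(i, j). F (rs ! i) (cs ! j))"

lemma fun_mat_carrier [simp]: "fun_mat rs cs F \<in> carrier_mat (length rs) (length cs)"
  by (simp add: fun_mat_def)

lemma fun_mat_dim [simp]:
  "dim_row (fun_mat rs cs F) = length rs" "dim_col (fun_mat rs cs F) = length cs"
  by (simp_all add: fun_mat_def)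

lemma fun_mat_index [simp]:
  "i < length rs \<Longrightarrow> j < length cs \<Longrightarrow> fun_mat rs cs F $$ (i, j) = F (rs ! i) (cs ! j)"
  by (simp add: fun_mat_def)

lemma fun_mat_cong:
  "(\<And>x y. x \<in> set rs \<Longrightarrow> y \<in> set cs \<Longrightarrow> F x y = E x y) \<Longrightarrow> fun_mat rs cs F = fun_mat rs cs E"
  by (intro eq_matI) auto

lemma fun_mat_mult:
  fixes F :: "'r \<Rightarrow> 'c \<Rightarrow> 'b :: semiring_0"
  assumes "distinct cs"
  shows "fun_mat rs cs F * fun_mat cs ds E = fun_mat rs ds (\<lambda>x z. \<Sum>y\<in>set cs. F x y * E y z)"
proof (intro eq_matI)
  fix i j
  assume ij: "i < dim_row (fun_mat rs ds (\<lambda>x z. \<Sum>y\<in>set cs. F x y * E y z))"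
    "j < dim_col (fun_mat rs ds (\<lambda>x z. \<Sum>y\<in>set cs. F x y * E y z))"
  have "(\<Sum>l<length cs. F (rs ! i) (cs ! l) * E (cs ! l) (ds ! j))
      = (\<Sum>y\<in>set cs. F (rs ! i) y * E y (ds ! j))"
    by (rule sum.reindex_bij_betw[OF bij_betw_nth[OF assms refl refl]])
  then show "(fun_mat rs cs F * fun_mat cs ds E) $$ (i, j)
      = fun_mat rs ds (\<lambda>x z. \<Sum>y\<in>set cs. F x y * E y z) $$ (i, j)"
    using ij by (simp add: scalar_prod_def atLeast0LessThan)
qed auto

lemma fun_mat_one: "distinct xs \<Longrightarrow> fun_mat xs xs (\<lambda>x y. if x = y then 1 else 0) = 1\<^sub>m (length xs)"
  by (intro eq_matI) (auto simp: nth_eq_iff_index_eq)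

text \<open>The same permutation acts on rows and columns, so its sign enters twice and cancels;
  columns are permuted by transposing. An arbitrary enumeration of the join can thus be exchanged
  for one that goes part by part.\<close>

lemma det_fun_mat_reorder:
  fixes F :: "'r \<Rightarrow> 'r \<Rightarrow> 'b :: comm_ring_1"
  assumes xs: "distinct xs" and ys: "distinct ys" and eq: "set xs = set ys"
  shows "det (fun_mat xs xs F) = det (fun_mat ys ys F)"
proof -
  let ?n = "length ys"
  have len: "length xs = ?n" using assms by (metis distinct_card)
  obtain p where p: "p permutes {..<?n}" "permute_list p ys = xs"
    using mset_eq_permutation[of xs ys] set_eq_iff_mset_eq_distinct[OF xs ys] eq by metis
  have p': "p permutes {0..<?n}" using p(1) by (simp add: atLeast0LessThan)
  have nth: "xs ! i = ys ! p i" if "i < ?n" for i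
    using p that by (metis permute_list_nth)
  have lt: "p i < ?n" if "i < ?n" for i
    using p(1) that by (metis lessThan_iff permutes_in_image)
  have 1: "fun_mat xs xs F = mat ?n ?n (\<lambda>(i, j). fun_mat ys xs F $$ (p i, j))"
    by (intro eq_matI) (auto simp: len nth lt)
  have 2: "transpose_mat (fun_mat ys xs F) = mat ?n ?n (\<lambda>(i, j). transpose_mat (fun_mat ys ys F) $$ (p i, j))"
    by (intro eq_matI) (auto simp: len nth lt)
  have c: "fun_mat ys xs F \<in> carrier_mat ?n ?n" using fun_mat_carrier[of ys xs F] len by simp
  have "det (fun_mat xs xs F) = signof p * det (fun_mat ys xs F)"
    unfolding 1 by (rule det_permute_rows[OF c p'])
  also have "det (fun_mat ys xs F) = det (transpose_mat (fun_mat ys xs F))"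
    using det_transpose[OF c] by simp
  also have "\<dots> = signof p * det (transpose_mat (fun_mat ys ys F))"
    unfolding 2 by (rule det_permute_rows[OF _ p']) simp
  also have "det (transpose_mat (fun_mat ys ys F)) = det (fun_mat ys ys F)"
    by (rule det_transpose[OF fun_mat_carrier])
  finally show ?thesis by (simp add: sign_def)
qed

lemma det_fun_mat_append:
  fixes F :: "'r \<Rightarrow> 'r \<Rightarrow> 'b :: idom"
  assumes "\<And>x y. x \<in> set xs \<Longrightarrow> y \<in> set ys \<Longrightarrow> F x y = 0"
  shows "det (fun_mat (xs @ ys) (xs @ ys) F) = det (fun_mat xs xs F) * det (fun_mat ys ys F)"
proof -
  have eq: "fun_mat (xs @ ys) (xs @ ys) F = four_block_mat (fun_mat xs xs F) (0\<^sub>m (length xs) (length ys))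
      (fun_mat ys xs F) (fun_mat ys ys F)"
    using assms by (intro eq_matI) (auto simp: nth_append)
  show ?thesis
    unfolding eq by (rule det_four_block_mat_upper_right_zero[OF _ refl]; simp)
qed

text \<open>Since \<open>vs\<close> has no repetitions, the pairs over its head share no first
  component with the later ones. The block of the head therefore splits off, and induction handles
  the rest.\<close>

lemma det_fun_mat_block_diag:
  fixes B :: "'h \<Rightarrow> 'a \<Rightarrow> 'a \<Rightarrow> 'b :: idom" and us :: "'h \<Rightarrow> 'a list"
  assumes "distinct vs"
  defines "F \<equiv> \<lambda>p q. if fst p = fst q then B (fst p) (snd p) (snd q) else 0"
    and "ps \<equiv> \<lambda>xs. concat (map (\<lambda>x. map (Pair x) (us x)) xs)"
  shows "det (fun_mat (ps vs) (ps vs) F) = (\<Prod>x\<in>set vs. det (fun_mat (us x) (us x) (B x)))"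
  using assms(1)
proof (induction vs)
  case Nil
  then show ?case by (simp add: fun_mat_def ps_def)
next
  case (Cons x vs)
  have "det (fun_mat (ps (x # vs)) (ps (x # vs)) F)
      = det (fun_mat (map (Pair x) (us x)) (map (Pair x) (us x)) F) * det (fun_mat (ps vs) (ps vs) F)"
    using Cons.prems by (simp add: ps_def) (rule det_fun_mat_append, auto simp: F_def)
  also have "fun_mat (map (Pair x) (us x)) (map (Pair x) (us x)) F = fun_mat (us x) (us x) (B x)"
    by (rule eq_matI) (simp_all add: F_def)
  finally show ?case using Cons by simp
qed

text \<open>Row scaling is left multiplication by a diagonal matrix. It is applied with the factors
  \<Gamma> for \<open>Mtilde\<close> and \<open>g\<close> for \<open>\<Phi>mat\<close>.\<close>

lemma det_fun_mat_scale_rows: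
  fixes F :: "'r \<Rightarrow> 'r \<Rightarrow> 'b :: comm_ring_1"
  assumes xs: "distinct xs"
  shows "det (fun_mat xs xs (\<lambda>x y. h x * F x y)) = (\<Prod>x\<in>set xs. h x) * det (fun_mat xs xs F)"
proof -
  let ?n = "length xs"
  let ?D = "mat_diag ?n (\<lambda>i. h (xs ! i))"
  have "fun_mat xs xs (\<lambda>x y. h x * F x y) = ?D * fun_mat xs xs F"
    unfolding mat_diag_mult_left[OF fun_mat_carrier] by (intro eq_matI) auto
  then have "det (fun_mat xs xs (\<lambda>x y. h x * F x y)) = det ?D * det (fun_mat xs xs F)"
    by (simp add: det_mult[of _ ?n])
  also have "det ?D = prod_list (diag_mat ?D)"
    by (rule det_upper_triangular) (auto simp: mat_diag_def)
  also have "diag_mat ?D = map h xs"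
    by (intro nth_equalityI) (auto simp: diag_mat_def mat_diag_def)
  also have "prod_list (map h xs) = (\<Prod>x\<in>set xs. h x)"
    using xs by (rule prod.distinct_set_conv_list[symmetric])
  finally show ?thesis .
qed

section \<open>Sylvester's identity and the determinant of a join\<close>

text \<open>The block matrix \<open>?L\<close> is multiplied by the unipotent \<open>?U\<close> once
  on the left and once on the right. Both products are block upper triangular, with nontrivial
  diagonal block \<open>1 - B * A\<close> and \<open>1 - A * B\<close> respectively, and both have
  determinant \<open>det ?U * det ?L\<close>. No division occurs.\<close>

lemma det_one_minus_mult_commute:
  fixes A :: "'b :: idom mat"
  assumes A: "A \<in> carrier_mat n k" and B: "B \<in> carrier_mat k n"
  shows "det (1\<^sub>m n - A * B) = det (1\<^sub>m k - B * A)"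
proof -
  let ?L = "four_block_mat (1\<^sub>m n) A B (1\<^sub>m k)"
  have L: "?L \<in> carrier_mat (n + k) (n + k)" using A B by simp
  let ?U = "four_block_mat (1\<^sub>m n) (0\<^sub>m n k) (- B) (1\<^sub>m k)"
  have U: "?U \<in> carrier_mat (n + k) (n + k)" using A B by simp
  have "?U * ?L = four_block_mat (1\<^sub>m n) A (0\<^sub>m k n) (1\<^sub>m k - B * A)"
    using A B by (subst mult_four_block_mat[of _ n n _ k _ k _ _ n _ k])
      (auto intro!: cong_four_block_mat simp: uminus_l_inv_mat)
  then have "det ?U * det ?L = det (four_block_mat (1\<^sub>m n) A (0\<^sub>m k n) (1\<^sub>m k - B * A))"
    using det_mult[OF U L] by simp
  also have "\<dots> = det (1\<^sub>m k - B * A)"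
    using A B by (subst det_four_block_mat_lower_left_zero[of _ n _ k]) (auto intro!: minus_carrier_mat)
  finally have 1: "det ?U * det ?L = det (1\<^sub>m k - B * A)" .
  have AB: "A * (- B) = - (A * B)" using A B by simp
  have "?L * ?U = four_block_mat (1\<^sub>m n - A * B) A (0\<^sub>m k n) (1\<^sub>m k)"
    unfolding mult_four_block_mat[OF one_carrier_mat A B one_carrier_mat
        one_carrier_mat zero_carrier_mat uminus_carrier_mat[OF B] one_carrier_mat] AB
    using A B by (intro cong_four_block_mat) (auto simp: add_uminus_minus_mat[of _ n n])
  then have "det ?L * det ?U = det (four_block_mat (1\<^sub>m n - A * B) A (0\<^sub>m k n) (1\<^sub>m k))"
    using det_mult[OF L U] by simp
  also have "\<dots> = det (1\<^sub>m n - A * B)"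
    using A B by (subst det_four_block_mat_lower_left_zero[of _ n _ k]) (auto intro!: minus_carrier_mat)
  finally show ?thesis using 1 by (simp add: mult.commute)
qed

text \<open>The vector \<open>c x\<close> is \<open>B\<^sub>x\<^sup>-\<^sup>1 1\<close>; no other part of the inverse of the block enters.\<close>

lemma det_join:
  fixes B :: "'h \<Rightarrow> 'a \<Rightarrow> 'a \<Rightarrow> 'b :: idom"
  assumes vs: "distinct vs" and us: "\<And>x. x \<in> set vs \<Longrightarrow> distinct (us x)"
    and ws: "distinct ws" "set ws = (SIGMA x:set vs. set (us x))"
    and c: "\<And>x u. x \<in> set vs \<Longrightarrow> u \<in> set (us x) \<Longrightarrow> (\<Sum>v\<in>set (us x). B x u v * c x v) = 1"
  shows "det (fun_mat ws ws (\<lambda>p q. (if fst p = fst q then B (fst p) (snd p) (snd q) else 0)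
               - R (fst p) (fst q)))
       = (\<Prod>x\<in>set vs. det (fun_mat (us x) (us x) (B x)))
         * det (fun_mat vs vs (\<lambda>x y. (if x = y then 1 else 0) - (\<Sum>u\<in>set (us x). c x u) * R x y))"
proof -
  let ?n = "length ws" and ?k = "length vs"
  let ?F = "\<lambda>p q. if fst p = fst q then B (fst p) (snd p) (snd q) else 0"
  let ?B = "fun_mat ws ws ?F"
  \<comment> \<open>Here \<open>?E\<close> has the parts as rows and the vertices as columns, and
    \<open>?C\<close> plays the role of \<open>B^-1 E^t R\<close>. Multiplying by \<open>?B\<close>
    repeats each row of \<open>R\<close> once per vertex of the part, because \<open>c x\<close>
    solves the system with right-hand side 1.\<close>
  let ?C = "fun_mat ws vs (\<lambda>p y. c (fst p) (snd p) * R (fst p) y)"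
  let ?E = "fun_mat vs ws (\<lambda>x q. if x = fst q then 1 else 0)"
  have fin: "finite (set vs)" "finite (set (us x))" for x by auto
  have BC: "?B * ?C = fun_mat ws vs (\<lambda>p y. R (fst p) y)"
  proof (unfold fun_mat_mult[OF ws(1)], rule fun_mat_cong)
    fix p y assume p: "p \<in> set ws"
    obtain x u where [simp]: "p = (x, u)" by (cases p)
    have xu: "x \<in> set vs" "u \<in> set (us x)" using p ws by auto
    have "(\<Sum>q\<in>set ws. ?F p q * (c (fst q) (snd q) * R (fst q) y))
        = (\<Sum>z\<in>set vs. \<Sum>v\<in>set (us z). ?F p (z, v) * (c z v * R z y))"
      unfolding ws(2) by (subst sum.Sigma) (auto intro!: sum.cong)
    also have "\<dots> = (\<Sum>z\<in>set vs. if x = z then (\<Sum>v\<in>set (us x). B x u v * (c x v * R x y)) else 0)"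
      by (intro sum.cong) auto
    also have "\<dots> = (\<Sum>v\<in>set (us x). B x u v * c x v) * R x y"
      using xu by (simp add: sum_distrib_right mult.assoc)
    finally show "(\<Sum>q\<in>set ws. ?F p q * (c (fst q) (snd q) * R (fst q) y)) = R (fst p) y"
      using c[OF xu] by simp
  qed
  have BCE: "?B * ?C * ?E = fun_mat ws ws (\<lambda>p q. R (fst p) (fst q))"
    unfolding BC fun_mat_mult[OF vs] using ws(2)
    by (intro fun_mat_cong) (auto simp: if_distrib cong: if_cong)
  have EC: "?E * ?C = fun_mat vs vs (\<lambda>x y. (\<Sum>u\<in>set (us x). c x u) * R x y)"
  proof (unfold fun_mat_mult[OF ws(1)], rule fun_mat_cong)
    fix x y assume x: "x \<in> set vs"
    have "(\<Sum>q\<in>set ws. (if x = fst q then 1 else 0) * (c (fst q) (snd q) * R (fst q) y))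
        = (\<Sum>z\<in>set vs. \<Sum>v\<in>set (us z). (if x = z then 1 else 0) * (c z v * R z y))"
      unfolding ws(2) by (subst sum.Sigma) (auto intro!: sum.cong)
    also have "\<dots> = (\<Sum>z\<in>set vs. if x = z then (\<Sum>v\<in>set (us x). c x v * R x y) else 0)"
      by (intro sum.cong) auto
    finally show "(\<Sum>q\<in>set ws. (if x = fst q then 1 else 0) * (c (fst q) (snd q) * R (fst q) y))
        = (\<Sum>u\<in>set (us x). c x u) * R x y"
      using x by (simp add: sum_distrib_right)
  qed
  have carr: "?B \<in> carrier_mat ?n ?n" "?C \<in> carrier_mat ?n ?k" "?E \<in> carrier_mat ?k ?n"
    by simp_all
  \<comment> \<open>Factoring out \<open>?B\<close> leaves \<open>1 - C E\<close>, indexed by all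
    vertices; Sylvester's identity reduces it to a matrix indexed by the parts.\<close>
  have "fun_mat ws ws (\<lambda>p q. ?F p q - R (fst p) (fst q)) = ?B - ?B * ?C * ?E"
    unfolding BCE by (intro eq_matI) auto
  also have "\<dots> = ?B * (1\<^sub>m ?n - ?C * ?E)"
    using carr mult_minus_distrib_mat[OF carr(1) one_carrier_mat mult_carrier_mat[OF carr(2,3)]]
    by (simp add: assoc_mult_mat[OF carr])
  also have "det \<dots> = det ?B * det (1\<^sub>m ?n - ?C * ?E)"
    using carr by (intro det_mult[of _ ?n]) auto
  also have "det (1\<^sub>m ?n - ?C * ?E) = det (1\<^sub>m ?k - ?E * ?C)"
    by (rule det_one_minus_mult_commute[OF carr(2,3)])
  also have "1\<^sub>m ?k - ?E * ?C = fun_mat vs vs (\<lambda>x y. (if x = y then 1 else 0) - (\<Sum>u\<in>set (us x). c x u) * R x y)"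
    unfolding EC fun_mat_one[OF vs, symmetric] by (intro eq_matI) auto
  also have "det ?B = (\<Prod>x\<in>set vs. det (fun_mat (us x) (us x) (B x)))"
  proof -
    \<comment> \<open>Listing the vertices part after part makes the matrix block diagonal;
      \<open>ws\<close> itself may interleave the parts.\<close>
    let ?ws = "concat (map (\<lambda>x. map (Pair x) (us x)) vs)"
    have d: "distinct ?ws"
      using vs us by (induction vs) (auto simp: distinct_map inj_on_def)
    have s: "set ws = set ?ws" unfolding ws(2) by auto
    show ?thesis
      unfolding det_fun_mat_reorder[OF ws(1) d s] by (rule det_fun_mat_block_diag[OF vs])
  qed
  finally show ?thesis .
qed

section \<open>Diagonalization of real symmetric matrices\<close>

text \<open>As \<open>A\<close> is real, the conjugate of an eigenvector \<open>v\<close> belongs to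
  \<open>cnj a\<close>. Symmetry moves \<open>A\<close> across the product of \<open>v\<close> with
  its conjugate, which is nonzero, so \<open>a = cnj a\<close>.\<close>

lemma real_symmetric_eigenvalue_real:
  fixes A :: "real mat"
  assumes A: "A \<in> carrier_mat n n" and sym: "transpose_mat A = A"
    and ev: "eigenvalue (map_mat complex_of_real A) a"
  shows "a \<in> \<real>"
proof -
  let ?A = "map_mat complex_of_real A"
  have cA: "?A \<in> carrier_mat n n" using A by simp
  obtain v where v: "v \<in> carrier_vec n" "v \<noteq> 0\<^sub>v n" and Av: "?A *\<^sub>v v = a \<cdot>\<^sub>v v"
    using ev A by (auto simp: eigenvalue_def eigenvector_def)
  have cv: "conjugate v \<in> carrier_vec n" using v by simp
  have "conjugate (?A *\<^sub>v v) = ?A *\<^sub>v conjugate v"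
    using A v by (intro eq_vecI) (auto simp: scalar_prod_def)
  then have cAv: "?A *\<^sub>v conjugate v = cnj a \<cdot>\<^sub>v conjugate v"
    using v by (simp add: Av conjugate_smult_vec)
  have tA: "transpose_mat ?A = ?A" using sym
    by (metis map_mat_transpose)
  have "a * (v \<bullet> conjugate v) = (?A *\<^sub>v v) \<bullet> conjugate v"
    using v by (simp add: Av)
  also have "\<dots> = v \<bullet> (?A *\<^sub>v conjugate v)"
    using transpose_vec_mult_scalar[OF cA cv v(1)] tA by metis
  also have "\<dots> = cnj a * (v \<bullet> conjugate v)" using v by (simp add: cAv)
  finally have "a = cnj a" using v by simp
  then show ?thesis by (simp add: Reals_cnj_iff)
qed

text \<open>The polynomial splits over the complex numbers, all its roots are real by the preceding
  lemma, and the factorization descends because the embedding of real polynomials is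
  injective.\<close>

lemma real_symmetric_char_poly_splits:
  fixes A :: "real mat"
  assumes A: "A \<in> carrier_mat n n" and sym: "transpose_mat A = A"
  shows "\<exists>ds. char_poly A = (\<Prod>d\<leftarrow>ds. [:-d, 1:])"
proof -
  interpret complex_poly_hom: map_poly_inj_idom_hom complex_of_real ..
  let ?A = "map_mat complex_of_real A"
  have cA: "?A \<in> carrier_mat n n" using A by simp
  from char_poly_factorized[OF cA] obtain as
    where as: "char_poly ?A = (\<Prod>a\<leftarrow>as. [:-a, 1:])" by blast
  have "a \<in> \<real>" if "a \<in> set as" for a
  proof -
    have "poly (char_poly ?A) a = 0" using that by (auto simp: as poly_prod_list prod_list_zero_iff)
    then show ?thesis
      using real_symmetric_eigenvalue_real[OF A sym] eigenvalue_root_char_poly[OF cA] by blast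
  qed
  then have "as = map complex_of_real (map Re as)"
    by (simp add: map_idI)
  then obtain ds where ds: "as = map complex_of_real ds" by blast
  then have "map_poly complex_of_real (char_poly A)
      = map_poly complex_of_real (\<Prod>d\<leftarrow>ds. [:-d, 1:])"
    by (subst of_real_hom.char_poly_hom[OF A, symmetric], subst as)
       (simp add: ds complex_poly_hom.hom_prod_list o_def)
  then have "char_poly A = (\<Prod>d\<leftarrow>ds. [:-d, 1:])"
    by (simp only: complex_poly_hom.eq_iff)
  then show ?thesis by blast
qed

lemma jordan_matrix_blocks_1:
  assumes "\<forall>(m, a) \<in> set n_as. m = 1"
  shows "jordan_matrix n_as = mat_diag (length n_as) (\<lambda>i. snd (n_as ! i))"
  using assms
proof (induction n_as)
  case Nil
  then show ?case by (intro eq_matI) (auto simp: jordan_matrix_def mat_diag_def)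
next
  case (Cons p n_as)
  obtain a where p: "p = (1, a)" using Cons.prems by (cases p) auto
  have len: "sum_list (map fst n_as) = length n_as"
    using Cons.prems by (induction n_as) auto
  show ?case
    using Cons unfolding p jordan_matrix_Cons
    by (intro eq_matI) (auto simp: mat_diag_def len nth_Cons')
qed

text \<open>
  If \<open>C\<close> is symmetric and \<open>C\<^sup>2 v = 0\<close>, then \<open>\<bar>C v\<bar>\<^sup>2 = v \<bullet> C\<^sup>2 v = 0\<close>. With \<open>C = A - aI\<close> this shows that
  all Jordan blocks of \<open>A\<close> have size one.
\<close>

lemma real_symmetric_diagonalizable:
  fixes A :: "real mat"
  assumes A: "A \<in> carrier_mat n n" and sym: "transpose_mat A = A"
  obtains d P Q where "similar_mat_wit A (mat_diag n d) P Q"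
proof -
  obtain ds where "char_poly A = (\<Prod>d\<leftarrow>ds. [:-d, 1:])"
    using real_symmetric_char_poly_splits[OF A sym] by blast
  from jordan_nf_exists[OF A this] obtain n_as where jnf: "jordan_nf A n_as" by blast
  have pos: "m > 0" if "(m, a) \<in> set n_as" for m a
    using jnf that unfolding jordan_nf_def by force
  have ker: "mat_kernel (char_matrix A a ^\<^sub>m 2) = mat_kernel (char_matrix A a ^\<^sub>m 1)" for a
  proof -
    let ?C = "char_matrix A a"
    have C: "?C \<in> carrier_mat n n" using A by simp
    have tC: "transpose_mat ?C = ?C"
    proof (intro eq_matI)
      fix i j assume ij: "i < dim_row ?C" "j < dim_col ?C"
      then have ij: "i < n" "j < n" using carrier_matD[OF C] by simp_all
      have "A $$ (j, i) = A $$ (i, j)"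
        using A ij arg_cong[OF sym, of "\<lambda>M. M $$ (i, j)"] by simp
      then show "transpose_mat ?C $$ (i, j) = ?C $$ (i, j)"
        using A ij by (auto simp: char_matrix_def)
    qed (use C in auto)
    have "?C *\<^sub>v v = 0\<^sub>v n" if v: "v \<in> carrier_vec n" and 0: "(?C * ?C) *\<^sub>v v = 0\<^sub>v n" for v
    proof -
      let ?w = "?C *\<^sub>v v"
      have w: "?w \<in> carrier_vec n" using C v by simp
      have "?w \<bullet> ?w = (?C *\<^sub>v ?w) \<bullet> v"
        using transpose_vec_mult_scalar[OF C v w] tC by simp
      also have "\<dots> = 0" using 0 C v by simp
      finally have "?w \<bullet> conjugate ?w = 0" by (simp add: conjugate_vec_def)
      then show ?thesis using conjugate_square_eq_0_vec[OF w] by simp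
    qed
    then show ?thesis
      using C by (auto simp: mat_kernel_def numeral_2_eq_2)
  qed
  have "m = 1" if mem: "(m, a) \<in> set n_as" for m a
  proof -
    let ?ns = "map fst [(m, e) \<leftarrow> n_as. e = a]"
    \<comment> \<open>The generalized eigenspace of order \<open>k\<close> has as dimension the sum
      of \<open>min k m\<close> over the sizes \<open>m\<close> of the blocks at \<open>a\<close>.
      Equal kernels for orders 1 and 2 thus give equal sums.\<close>
    have "dim_gen_eigenspace A a 2 = dim_gen_eigenspace A a 1"
      using A ker[of a] unfolding dim_gen_eigenspace_def kernel_dim_def by simp
    then have eq: "(\<Sum>m\<leftarrow>?ns. min 2 m) = (\<Sum>m\<leftarrow>?ns. min 1 m)"
      using dim_gen_eigenspace[OF jnf] by simp
    have "m \<in> set ?ns" using mem by force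
    then obtain xs ys where "?ns = xs @ m # ys" by (meson split_list)
    \<comment> \<open>The termwise inequality holds for the blocks on either side of the chosen one,
      so equality of the totals bounds the chosen term.\<close>
    moreover have "(\<Sum>m\<leftarrow>zs. min 1 m) \<le> (\<Sum>m\<leftarrow>zs. min 2 m)" for zs :: "nat list"
      by (intro sum_list_mono) auto
    from this[of xs] this[of ys] have "min 2 m \<le> min 1 m" using eq calculation by simp
    then show ?thesis using pos[OF mem] by simp
  qed
  then have J: "jordan_matrix n_as = mat_diag (length n_as) (\<lambda>i. snd (n_as ! i))"
    by (intro jordan_matrix_blocks_1) auto
  from jnf obtain P Q where sim: "similar_mat_wit A (jordan_matrix n_as) P Q"
    unfolding jordan_nf_def similar_mat_def by blast
  have "jordan_matrix n_as \<in> carrier_mat n n"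
    using sim A unfolding similar_mat_wit_def Let_def by auto
  then have "length n_as = n" unfolding J mat_diag_def by auto
  with sim J that show thesis by metis
qed

text \<open>\<open>Q * P = 1\<close> turns \<open>A = P D Q\<close> into \<open>A P = P D\<close>,
  which is read column by column.\<close>

lemma eigenvector_of_diagonalization:
  fixes A :: "'b :: comm_ring_1 mat"
  assumes wit: "similar_mat_wit A (mat_diag n d) P Q" and A: "A \<in> carrier_mat n n" and i: "i < n"
  shows "A *\<^sub>v col P i = d i \<cdot>\<^sub>v col P i"
proof -
  have P: "P \<in> carrier_mat n n" and Q: "Q \<in> carrier_mat n n" and QP: "Q * P = 1\<^sub>m n"
    and eq: "A = P * mat_diag n d * Q"
    using wit A unfolding similar_mat_wit_def Let_def by auto
  have "A * P = P * mat_diag n d * (Q * P)"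
    unfolding eq using P Q by (subst assoc_mult_mat[of _ n n _ n]) auto
  also have "\<dots> = P * mat_diag n d" using P by (simp add: QP right_mult_one_mat[of _ n])
  finally have AP: "A * P = mat n n (\<lambda>(i, j). P $$ (i, j) * d j)"
    by (simp add: mat_diag_mult_right[OF P])
  have "A *\<^sub>v col P i = col (A * P) i"
    using A P i by (intro eq_vecI) auto
  also have "\<dots> = d i \<cdot>\<^sub>v col P i"
    using P i unfolding AP by (intro eq_vecI) (auto simp: mult.commute)
  finally show ?thesis .
qed

section \<open>Eigenvalues and linear factors of the characteristic polynomial\<close>

text \<open>Later products over eigenvalues are split into factors, which relies on finiteness: over
  an infinite index set a product is 1 by convention.\<close>

lemma finite_eigenvalues:
  fixes A :: "'b :: field mat"
  assumes A: "A \<in> carrier_mat n n"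
  shows "finite {\<mu>. eigenvalue A \<mu>}"
proof -
  have "char_poly A \<noteq> 0" using degree_monic_char_poly[OF A] by auto
  then show ?thesis
    using poly_roots_finite by (simp add: eigenvalue_root_char_poly[OF A])
qed

text \<open>Equal factors of the real splitting are collected with \<open>proots\<close>, whose
  multiplicities are those of \<open>eig_mult\<close>. The splitting guarantees that no factor is
  lost to nonreal roots.\<close>

lemma real_symmetric_char_poly_factorization:
  fixes A :: "real mat"
  assumes A: "A \<in> carrier_mat n n" and sym: "transpose_mat A = A"
  shows "char_poly A = (\<Prod>\<mu> | eigenvalue A \<mu>. [:-\<mu>, 1:] ^ eig_mult A \<mu>)"
proof -
  obtain ds where ds: "char_poly A = (\<Prod>d\<leftarrow>ds. [:-d, 1:])"
    using real_symmetric_char_poly_splits[OF A sym] by blast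
  have nz: "char_poly A \<noteq> 0" using degree_monic_char_poly[OF A] by auto
  have roots: "proots (char_poly A) = mset ds"
    unfolding ds
  proof (induction ds)
    case (Cons d ds)
    have "proots ([:-d, 1:] * (\<Prod>d\<leftarrow>ds. [:-d, 1:])) = {#d#} + mset ds"
      by (subst proots_mult) (auto simp: Cons prod_list_zero_iff)
    then show ?case by (simp del: mult_pCons_left)
  qed simp
  have "char_poly A = (\<Prod>d\<in>#mset ds. [:-d, 1:])"
    unfolding ds by (simp flip: prod_mset_prod_list)
  also have "\<dots> = (\<Prod>\<mu>\<in>set_mset (proots (char_poly A)). [:-\<mu>, 1:] ^ eig_mult A \<mu>)"
    unfolding image_prod_mset_multiplicity roots[symmetric] eig_mult_def
    using nz by simp
  also have "set_mset (proots (char_poly A)) = {\<mu>. eigenvalue A \<mu>}"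
    using nz by (auto simp: eigenvalue_root_char_poly[OF A])
  finally show ?thesis .
qed

section \<open>Partial fractions of the main function\<close>

abbreviation fract_const :: "real \<Rightarrow> real poly fract" where
  "fract_const c \<equiv> to_fract [:c:]"

interpretation fract_const: inj_comm_ring_hom fract_const
  by unfold_locales (auto simp flip: to_fract_add to_fract_mult simp: pCons_one)

interpretation fract: inj_comm_ring_hom "to_fract :: 'b :: idom \<Rightarrow> 'b fract"
  by unfold_locales auto

text \<open>Substituting \<open>s\<close> and passing to fractions are ring homomorphisms, so both
  commute with the determinant defining \<open>char_poly\<close>.\<close>

lemma to_fract_char_poly_pcompose:
  fixes A :: "real mat"
  assumes A: "A \<in> carrier_mat n n"
  shows "to_fract (char_poly A \<circ>\<^sub>p s) = det (to_fract s \<cdot>\<^sub>m 1\<^sub>m n - map_mat fract_const A)"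
proof -
  have "to_fract (char_poly A \<circ>\<^sub>p s)
      = det (map_mat to_fract (map_mat (\<lambda>q. q \<circ>\<^sub>p s) (char_poly_matrix A)))"
    by (simp add: char_poly_def comm_ring_hom.hom_det[OF pcompose_hom.comm_ring_hom_axioms] fract.hom_det)
  also have "map_mat to_fract (map_mat (\<lambda>q. q \<circ>\<^sub>p s) (char_poly_matrix A))
      = to_fract s \<cdot>\<^sub>m 1\<^sub>m n - map_mat fract_const A"
    using A by (intro eq_matI)
      (auto simp: char_poly_matrix_def pcompose_pCons fract_const.hom_uminus)
  finally show ?thesis .
qed

text \<open>In the diagonalizing basis \<open>N\<close> becomes the diagonal matrix with entries
  \<open>\<xi> - d i\<close>, all nonzero by hypothesis, so only these entries have to be
  inverted.\<close>

lemma resolvent_inverse: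
  fixes A :: "real mat"
  assumes wit: "similar_mat_wit A (mat_diag n d) P Q" and A: "A \<in> carrier_mat n n"
    and \<xi>: "\<And>i. i < n \<Longrightarrow> \<xi> \<noteq> fract_const (d i)"
  defines "N \<equiv> \<xi> \<cdot>\<^sub>m 1\<^sub>m n - map_mat fract_const A"
  shows "mat_inverse N = Some (map_mat fract_const P
           * mat_diag n (\<lambda>i. 1 / (\<xi> - fract_const (d i))) * map_mat fract_const Q)"
    (is "_ = Some (?P * ?E * ?Q)")
    and "N * the (mat_inverse N) = 1\<^sub>m n"
proof -
  let ?D = "mat_diag n (\<lambda>i. \<xi> - fract_const (d i))"
  have P: "P \<in> carrier_mat n n" and Q: "Q \<in> carrier_mat n n"
    and PQ: "P * Q = 1\<^sub>m n" and QP: "Q * P = 1\<^sub>m n" and eq: "A = P * mat_diag n d * Q"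
    using wit A unfolding similar_mat_wit_def Let_def by auto
  have P': "?P \<in> carrier_mat n n" and Q': "?Q \<in> carrier_mat n n" using P Q by simp_all
  have PQ': "?P * ?Q = 1\<^sub>m n" and QP': "?Q * ?P = 1\<^sub>m n"
    using fract_const.mat_hom_mult[OF P Q] fract_const.mat_hom_mult[OF Q P]
    by (simp_all add: PQ QP fract_const.mat_hom_one)
  have E: "?E \<in> carrier_mat n n" and D: "?D \<in> carrier_mat n n" by simp_all
  have ED: "?E * ?D = 1\<^sub>m n"
    using \<xi> unfolding mat_diag_diag by (intro eq_matI) (auto simp: mat_diag_def)
  have "map_mat fract_const A = ?P * map_mat fract_const (mat_diag n d) * ?Q"
    using P Q by (simp add: eq fract_const.mat_hom_mult[of _ n n _ n])
  moreover have "\<xi> \<cdot>\<^sub>m 1\<^sub>m n = ?P * (\<xi> \<cdot>\<^sub>m 1\<^sub>m n) * ?Q"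
    using P' Q' by (simp add: mult_smult_distrib[of _ n n _ n] mult_smult_assoc_mat[of _ n n _ n]
      right_mult_one_mat[of _ n] PQ')
  moreover have "\<xi> \<cdot>\<^sub>m 1\<^sub>m n - map_mat fract_const (mat_diag n d) = ?D"
    by (intro eq_matI) (auto simp: mat_diag_def)
  ultimately have N: "N = ?P * ?D * ?Q"
    using P' Q' minus_mult_distrib_mat[of "?P * (\<xi> \<cdot>\<^sub>m 1\<^sub>m n)" n n "?P * map_mat fract_const (mat_diag n d)" ?Q n]
      mult_minus_distrib_mat[of ?P n n "\<xi> \<cdot>\<^sub>m 1\<^sub>m n" n "map_mat fract_const (mat_diag n d)"]
    by (simp add: N_def)
  have Nc: "N \<in> carrier_mat n n" and Ic: "?P * ?E * ?Q \<in> carrier_mat n n"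
    using A P' Q' by (auto simp: N_def)
  have "(?P * ?E * ?Q) * N = ?P * ?E * (?Q * ?P) * ?D * ?Q"
    unfolding N using P' Q' by (simp add: assoc_mult_mat[of _ n n _ n _ n] mult_carrier_mat[of _ n n _ n])
  also have "\<dots> = ?P * (?E * ?D) * ?Q"
    using P' Q' unfolding QP' by (simp add: assoc_mult_mat[of _ n n _ n _ n] mult_carrier_mat[of _ n n _ n] right_mult_one_mat[of _ n])
  also have "\<dots> = 1\<^sub>m n"
    using P' PQ' unfolding ED by (simp add: right_mult_one_mat[of _ n])
  finally have left: "(?P * ?E * ?Q) * N = 1\<^sub>m n" .
  then have "N * (?P * ?E * ?Q) = 1\<^sub>m n"
    using mat_mult_left_right_inverse[OF Ic Nc] by simp
  \<comment> \<open>\<open>mat_inverse\<close> returns \<open>None\<close> only for a non-unit of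
    the matrix ring. Uniqueness of inverses then identifies its result \<open>X\<close> with the
    explicit product.\<close>
  then have "N \<in> Units (ring_mat TYPE(real poly fract) n ())"
    using left Nc Ic by (auto simp: Units_def ring_mat_def)
  then obtain X where X: "mat_inverse N = Some X"
    using mat_inverse(1)[OF Nc, of "()"] by (cases "mat_inverse N") auto
  note X' = mat_inverse(2)[OF Nc X]
  have "X = (?P * ?E * ?Q) * N * X"
    unfolding left using X' left_mult_one_mat[of X n n] by simp
  also have "\<dots> = (?P * ?E * ?Q) * (N * X)"
    by (rule assoc_mult_mat[OF Ic Nc]) (use X' in blast)
  also have "\<dots> = ?P * ?E * ?Q" using X' right_mult_one_mat[OF Ic] by simp
  finally show "mat_inverse N = Some (?P * ?E * ?Q)" using X by simp
  show "N * the (mat_inverse N) = 1\<^sub>m n" using X X' by simp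
qed

text \<open>Expanding \<open>1^t P E Q 1\<close> with \<open>E\<close> diagonal, the residue at
  \<open>d i\<close> is a column sum of \<open>P\<close> times a row sum of
  \<open>Q\<close>.\<close>

lemma main_function_partial_fractions:
  assumes wit: "similar_mat_wit A (mat_diag n d) P Q" and A: "A \<in> carrier_mat n n"
    and \<xi>: "\<And>i. i < n \<Longrightarrow> \<xi> \<noteq> fract_const (d i)"
  shows "main_function A \<xi> = (\<Sum>i<n. fract_const ((\<Sum>j<n. P $$ (j, i)) * (\<Sum>j<n. Q $$ (i, j)))
           / (\<xi> - fract_const (d i)))"
proof -
  let ?e = "\<lambda>i. 1 / (\<xi> - fract_const (d i))"
  let ?E = "mat_diag n ?e"
  let ?P = "map_mat fract_const P" and ?Q = "map_mat fract_const Q"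
  let ?q = "\<lambda>i. \<Sum>j<n. fract_const (Q $$ (i, j))"
  have P: "P \<in> carrier_mat n n" and Q: "Q \<in> carrier_mat n n"
    using wit A unfolding similar_mat_wit_def Let_def by auto
  have P': "?P \<in> carrier_mat n n" and Q': "?Q \<in> carrier_mat n n" using P Q by simp_all
  have o: "ones_vec n \<in> carrier_vec n" by (simp add: ones_vec_def)
  have "main_function A \<xi> = ones_vec n \<bullet> (?P * ?E * ?Q *\<^sub>v ones_vec n)"
    using resolvent_inverse(1)[OF wit A \<xi>] A by (simp add: main_function_def)
  also have "?P * ?E * ?Q *\<^sub>v ones_vec n = ?P * ?E *\<^sub>v (?Q *\<^sub>v ones_vec n)"
    using P' Q' o by (intro assoc_mult_mat_vec[of _ n n _ n]) auto
  also have "?Q *\<^sub>v ones_vec n = vec n ?q"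
    using Q by (intro eq_vecI) (auto simp: scalar_prod_def ones_vec_def atLeast0LessThan)
  also have "?P * ?E *\<^sub>v vec n ?q = vec n (\<lambda>j. \<Sum>i<n. fract_const (P $$ (j, i)) * ?e i * ?q i)"
    unfolding mat_diag_mult_right[OF P']
    using P by (intro eq_vecI) (auto simp: scalar_prod_def atLeast0LessThan)
  also have "ones_vec n \<bullet> \<dots> = (\<Sum>j<n. \<Sum>i<n. fract_const (P $$ (j, i)) * ?e i * ?q i)"
    by (simp add: scalar_prod_def ones_vec_def atLeast0LessThan)
  also have "\<dots> = (\<Sum>i<n. \<Sum>j<n. fract_const (P $$ (j, i)) * ?e i * ?q i)"
    by (rule sum.swap)
  also have "\<dots> = (\<Sum>i<n. fract_const ((\<Sum>j<n. P $$ (j, i)) * (\<Sum>j<n. Q $$ (i, j))) / (\<xi> - fract_const (d i)))"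
    by (simp add: fract_const.hom_mult fract_const.hom_sum sum_distrib_right sum_divide_distrib)
  finally show ?thesis .
qed

text \<open>A column sum of \<open>P\<close> is the inner product of an eigenvector with the
  all-ones vector, so a nonzero sum exhibits an eigenvector that is not orthogonal to it.\<close>

lemma main_eigenvalue_of_diagonalization:
  assumes wit: "similar_mat_wit A (mat_diag n d) P Q" and A: "A \<in> carrier_mat n n" and i: "i < n"
    and nz: "(\<Sum>j<n. P $$ (j, i)) \<noteq> 0"
  shows "main_eigenvalue A (d i)"
proof -
  have P: "P \<in> carrier_mat n n"
    using wit A unfolding similar_mat_wit_def Let_def by auto
  let ?v = "col P i"
  have dot: "?v \<bullet> ones_vec n = (\<Sum>j<n. P $$ (j, i))"
    using P i by (simp add: scalar_prod_def ones_vec_def atLeast0LessThan)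
  have v: "?v \<in> carrier_vec n" using P i by auto
  have "?v \<noteq> 0\<^sub>v n"
  proof
    assume "?v = 0\<^sub>v n"
    then have "?v \<bullet> ones_vec n = 0" by (simp add: scalar_prod_def ones_vec_def)
    with dot nz show False by simp
  qed
  then have "eigenvalue A (d i)"
    using v A eigenvector_of_diagonalization[OF wit A i]
    unfolding eigenvalue_def eigenvector_def by auto
  moreover have "?v \<in> eigenspace A (d i)"
    using v A eigenvector_of_diagonalization[OF wit A i] by (simp add: eigenspace_def)
  ultimately show ?thesis
    using dot nz carrier_matD(1)[OF A] unfolding main_eigenvalue_def by metis
qed

lemma to_fract_cancel_factor:
  "l \<noteq> 0 \<Longrightarrow> to_fract (l * r) * (to_fract a / to_fract l) = to_fract (a * r)"
  by simp

text \<open>After clearing denominators, the coefficient of degree \<open>n - 1\<close> is \<open>1\<^sup>t P Q 1 = n\<close>.\<close>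

lemma main_function_nonzero:
  fixes A :: "real mat"
  assumes A: "A \<in> carrier_mat n n" and sym: "transpose_mat A = A" and n: "n > 0"
  shows "main_function A (to_fract [:b, 1:]) \<noteq> 0"
proof
  assume zero: "main_function A (to_fract [:b, 1:]) = 0"
  obtain d P Q where wit: "similar_mat_wit A (mat_diag n d) P Q"
    using real_symmetric_diagonalizable[OF A sym] .
  have P: "P \<in> carrier_mat n n" and Q: "Q \<in> carrier_mat n n" and PQ: "P * Q = 1\<^sub>m n"
    using wit A unfolding similar_mat_wit_def Let_def by auto
  let ?l = "\<lambda>i. [:b - d i, 1:]"
  have l: "to_fract [:b, 1:] - fract_const (d i) = to_fract (?l i)" for i
    by (simp flip: to_fract_diff)
  have ne: "to_fract [:b, 1:] \<noteq> fract_const (d i)" for i by simp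
  let ?a = "\<lambda>i. (\<Sum>j<n. P $$ (j, i)) * (\<Sum>j<n. Q $$ (i, j))"
  let ?G = "\<Prod>i<n. ?l i"
  let ?R = "\<lambda>i. \<Prod>j\<in>{..<n} - {i}. ?l j"
  have "0 = to_fract ?G * (\<Sum>i<n. fract_const (?a i) / to_fract (?l i))"
    using zero main_function_partial_fractions[OF wit A ne] by (simp add: l)
  also have "\<dots> = (\<Sum>i<n. to_fract ?G * (fract_const (?a i) / to_fract (?l i)))"
    by (rule sum_distrib_left)
  also have "\<dots> = (\<Sum>i<n. to_fract ([:?a i:] * ?R i))"
  proof (rule sum.cong)
    fix i assume "i \<in> {..<n}"
    then have "?G = ?l i * ?R i" by (simp add: prod.remove)
    then show "to_fract ?G * (fract_const (?a i) / to_fract (?l i)) = to_fract ([:?a i:] * ?R i)"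
      by (simp only:) (rule to_fract_cancel_factor, simp)
  qed simp
  finally have "(\<Sum>i<n. [:?a i:] * ?R i) = 0"
    by (simp flip: to_fract_sum)
  then have "0 = coeff (\<Sum>i<n. [:?a i:] * ?R i) (n - 1)" by simp
  also have "\<dots> = (\<Sum>i<n. ?a i)"
  proof -
    have "coeff (?R i) (n - 1) = 1" if "i < n" for i
    proof -
      \<comment> \<open>\<open>?R i\<close> is a product of \<open>n - 1\<close> monic linear
        factors, so the coefficient in question is its leading one.\<close>
      have "degree (?R i) = n - 1" using that by (subst degree_prod_eq_sum_degree) auto
      moreover have "lead_coeff (?R i) = 1" by (simp add: lead_coeff_prod)
      ultimately show ?thesis by metis
    qed
    then show ?thesis by (simp add: coeff_sum)
  qed
  also have "\<dots> = (\<Sum>i<n. \<Sum>j<n. \<Sum>k<n. P $$ (j, i) * Q $$ (i, k))"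
    by (simp add: sum_product)
  also have "\<dots> = (\<Sum>j<n. \<Sum>i<n. \<Sum>k<n. P $$ (j, i) * Q $$ (i, k))"
    by (rule sum.swap)
  also have "\<dots> = (\<Sum>j<n. \<Sum>k<n. \<Sum>i<n. P $$ (j, i) * Q $$ (i, k))"
    by (intro sum.cong refl sum.swap)
  also have "\<dots> = (\<Sum>j<n. \<Sum>k<n. (P * Q) $$ (j, k))"
    using P Q by (intro sum.cong refl) (auto simp: scalar_prod_def atLeast0LessThan)
  also have "\<dots> = real n" unfolding PQ by simp
  finally show False using n by simp
qed

text \<open>Only main eigenvalues have nonzero residues in the partial fractions of the main function.\<close>

lemma main_function_clear_denominators:
  fixes A :: "real mat"
  assumes A: "A \<in> carrier_mat n n" and sym: "transpose_mat A = A"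
  shows "\<exists>p. to_fract p
      = to_fract (\<Prod>\<theta> | main_eigenvalue A \<theta>. [:b, 1:] - [:\<theta>:]) * main_function A (to_fract [:b, 1:])"
proof -
  obtain d P Q where wit: "similar_mat_wit A (mat_diag n d) P Q"
    using real_symmetric_diagonalizable[OF A sym] .
  let ?l = "\<lambda>\<theta>. [:b, 1:] - [:\<theta>:]"
  have ne: "to_fract [:b, 1:] \<noteq> fract_const (d i)" for i by simp
  let ?a = "\<lambda>i. (\<Sum>j<n. P $$ (j, i)) * (\<Sum>j<n. Q $$ (i, j))"
  let ?T = "{\<theta>. main_eigenvalue A \<theta>}"
  let ?G = "\<Prod>\<theta>\<in>?T. ?l \<theta>"
  let ?R = "\<lambda>i. \<Prod>\<theta>\<in>?T - {d i}. ?l \<theta>"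
  have fin: "finite ?T"
    using finite_eigenvalues[OF A] by (rule rev_finite_subset) (auto simp: main_eigenvalue_def)
  have "to_fract ?G * main_function A (to_fract [:b, 1:])
      = (\<Sum>i<n. to_fract ?G * (fract_const (?a i) / to_fract (?l (d i))))"
    unfolding main_function_partial_fractions[OF wit A ne] by (simp only: sum_distrib_left to_fract_diff)
  also have "\<dots> = (\<Sum>i<n. to_fract ([:?a i:] * ?R i))"
  proof (rule sum.cong)
    fix i assume i: "i \<in> {..<n}"
    show "to_fract ?G * (fract_const (?a i) / to_fract (?l (d i))) = to_fract ([:?a i:] * ?R i)"
    \<comment> \<open>A nonzero residue forces \<open>d i\<close> to be main, so its factor cancels
      against \<open>?G\<close>; a zero residue makes both sides vanish. Each summand has a simple
      pole, so one factor per distinct main eigenvalue suffices even if \<open>d\<close> repeats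
      values.\<close>
    proof (cases "?a i = 0")
      case False
      then have "d i \<in> ?T"
        using main_eigenvalue_of_diagonalization[OF wit A] i by auto
      then have "?G = ?l (d i) * ?R i" using fin by (simp add: prod.remove)
      then show ?thesis
        by (simp only:) (rule to_fract_cancel_factor, simp)
    next
      case True
      then show ?thesis by (simp only: True) simp
    qed
  qed simp
  finally show ?thesis
    by (intro exI[of _ "\<Sum>i<n. [:?a i:] * ?R i"]) (simp only: to_fract_sum)
qed

section \<open>The main function through a linear system\<close>

text \<open>In a list without repetitions an entry determines its position. Coordinates of a vector
  can thus be carried over to a function on vertices, as \<open>det_join\<close> expects.\<close>

lemma distinct_reindex:
  assumes "distinct xs"
  shows "\<exists>c. \<forall>i<length xs. c (xs ! i) = f i"
proof -
  have "(THE j. j < length xs \<and> xs ! j = xs ! i) = i" if "i < length xs" for i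
    using that assms by (auto simp: nth_eq_iff_index_eq)
  then show ?thesis
    by (intro exI[of _ "\<lambda>x. f (THE j. j < length xs \<and> xs ! j = x)"]) simp
qed

lemma mult_mat_vec_index:
  "N \<in> carrier_mat m n \<Longrightarrow> y \<in> carrier_vec n \<Longrightarrow> i < m \<Longrightarrow> (N *\<^sub>v y) $ i = (\<Sum>j<n. N $$ (i, j) * y $ j)"
  by (auto simp: scalar_prod_def atLeast0LessThan)

lemma ones_vec_scalar_prod:
  fixes y :: "'b :: semiring_1 vec"
  shows "y \<in> carrier_vec n \<Longrightarrow> ones_vec n \<bullet> y = (\<Sum>i<n. y $ i)"
  by (auto simp: scalar_prod_def ones_vec_def atLeast0LessThan)

text \<open>This supplies the \<open>c x\<close> of \<open>det_join\<close>: the coordinates of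
  \<open>N^-1 1\<close>, where \<open>N\<close> is the shifted matrix. Their sum is the inner
  product with the all-ones vector, hence the main function.\<close>

lemma main_function_linear_system:
  assumes us: "distinct us" and A: "A = fun_mat us us F" and sym: "transpose_mat A = A"
  shows "\<exists>c. (\<forall>u\<in>set us.
       (\<Sum>v\<in>set us. ((if u = v then to_fract [:b, 1:] else 0) - fract_const (F u v)) * c v) = 1) \<and>
     main_function A (to_fract [:b, 1:]) = (\<Sum>u\<in>set us. c u)"
proof -
  let ?n = "length us"
  let ?N = "to_fract [:b, 1:] \<cdot>\<^sub>m 1\<^sub>m ?n - map_mat fract_const A"
  let ?X = "the (mat_inverse ?N)"
  let ?y = "?X *\<^sub>v ones_vec ?n"
  have Ac: "A \<in> carrier_mat ?n ?n" by (simp add: A)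
  obtain d P Q where wit: "similar_mat_wit A (mat_diag ?n d) P Q"
    using real_symmetric_diagonalizable[OF Ac sym] .
  have ne: "to_fract [:b, 1:] \<noteq> fract_const (d i)" for i by simp
  note inv = resolvent_inverse[OF wit Ac ne]
  have Nc: "?N \<in> carrier_mat ?n ?n" using Ac by (intro minus_carrier_mat) simp
  have Xc: "?X \<in> carrier_mat ?n ?n"
    using mat_inverse(2)[OF Nc inv(1)] inv(1) by simp
  have oc: "(ones_vec ?n :: real poly fract vec) \<in> carrier_vec ?n" by (simp add: ones_vec_def)
  have y: "?y \<in> carrier_vec ?n" by (rule mult_mat_vec_carrier[OF Xc oc])
  have Ny: "?N *\<^sub>v ?y = ones_vec ?n"
    using assoc_mult_mat_vec[OF Nc Xc oc] one_mult_mat_vec[OF oc] by (simp add: inv(2))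
  obtain c where c: "\<forall>i<?n. c (us ! i) = ?y $ i"
    using distinct_reindex[OF us, of "\<lambda>i. ?y $ i"] by (rule exE)
  have reindex: "(\<Sum>u\<in>set us. h u) = (\<Sum>i<?n. h (us ! i))" for h :: "'a \<Rightarrow> real poly fract"
    by (rule sum.reindex_bij_betw[OF bij_betw_nth[OF us refl refl], symmetric])
  show ?thesis
  proof (intro exI conjI ballI)
    fix u assume "u \<in> set us"
    then obtain i where i: "i < ?n" "u = us ! i" by (auto simp: in_set_conv_nth)
    have "(\<Sum>v\<in>set us. ((if u = v then to_fract [:b, 1:] else 0) - fract_const (F u v)) * c v)
        = (\<Sum>j<?n. ?N $$ (i, j) * ?y $ j)"
      unfolding reindex using i us
      by (intro sum.cong refl) (auto simp: A c nth_eq_iff_index_eq)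
    also have "\<dots> = (?N *\<^sub>v ?y) $ i"
      by (rule mult_mat_vec_index[OF Nc y i(1), symmetric])
    also have "\<dots> = 1" unfolding Ny using i by (simp add: ones_vec_def)
    finally show "(\<Sum>v\<in>set us. ((if u = v then to_fract [:b, 1:] else 0) - fract_const (F u v)) * c v) = 1" .
  next
    show "main_function A (to_fract [:b, 1:]) = (\<Sum>u\<in>set us. c u)"
      unfolding main_function_def Let_def carrier_matD(1)[OF Ac] reindex ones_vec_scalar_prod[OF y]
      using c by (intro sum.cong) auto
  qed
qed

section \<open>Joins of graphs\<close>

definition graph_entry :: "real \<Rightarrow> 'a pair_pre_digraph \<Rightarrow> 'a \<Rightarrow> 'a \<Rightarrow> real" where
  "graph_entry t G u v = (if (u, v) \<in> parcs G then 1 else 0)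
     - t * (if u = v then real (out_degree (with_proj G) u) else 0)"

lemma adj_deg_matrix_eq_fun_mat:
  "distinct vs \<Longrightarrow> adj_deg_matrix t G vs = fun_mat vs vs (graph_entry t G)"
  by (intro eq_matI)
    (auto simp: adj_deg_matrix_def adjacency_matrix_def degree_matrix_def graph_entry_def nth_eq_iff_index_eq)

lemma adj_deg_matrix_carrier: "adj_deg_matrix t G vs \<in> carrier_mat (length vs) (length vs)"
  unfolding adj_deg_matrix_def degree_matrix_def by (intro minus_carrier_mat) simp

lemma transpose_adj_deg_matrix:
  assumes "pair_graph G"
  shows "transpose_mat (adj_deg_matrix t G vs) = adj_deg_matrix t G vs"
  using pair_graphD(3)[OF assms]
  by (intro eq_matI) (auto simp: adj_deg_matrix_def adjacency_matrix_def degree_matrix_def)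

lemma out_degree_eq_card: "out_degree (with_proj G) u = card {v. (u, v) \<in> parcs G}"
proof -
  have "out_arcs (with_proj G) u = Pair u ` {v. (u, v) \<in> parcs G}"
    by (auto simp: out_arcs_def)
  then show ?thesis by (simp add: out_degree_def card_image inj_on_def)
qed

text \<open>The neighbours of \<open>(x, u)\<close> are a copy of those of \<open>u\<close> and all
  vertices of \<open>G y\<close> for each \<open>y\<close> adjacent to \<open>x\<close>. As
  \<open>H\<close> has no loops, the two sets are disjoint and their sizes add.\<close>

lemma out_degree_hjoin:
  assumes H: "pair_graph H" and G: "\<And>x. x \<in> pverts H \<Longrightarrow> pair_graph (G x)"
    and x: "x \<in> pverts H" and u: "u \<in> pverts (G x)"
  shows "out_degree (with_proj (hjoin H G)) (x, u)
       = out_degree (with_proj (G x)) u + (\<Sum>y | (x, y) \<in> parcs H. card (pverts (G y)))"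
proof -
  interpret H: pair_graph H by (rule H)
  interpret Gx: pair_graph "G x" by (rule G[OF x])
  have nb: "{y. (x, y) \<in> parcs H} \<subseteq> pverts H" using pair_graphD(2)[OF H] by blast
  have finH: "finite {y. (x, y) \<in> parcs H}" using nb H.pair_finite_verts finite_subset by blast
  have finG: "finite (pverts (G y))" if "y \<in> pverts H" for y
  proof -
    interpret Gy: pair_graph "G y" by (rule G[OF that])
    show ?thesis by (rule Gy.pair_finite_verts)
  qed
  have finu: "finite {v. (u, v) \<in> parcs (G x)}"
    by (rule finite_subset[OF _ Gx.pair_finite_verts]) (use pair_graphD(2)[OF G[OF x]] in blast)
  have "{q. ((x, u), q) \<in> parcs (hjoin H G)}
      = Pair x ` {v. (u, v) \<in> parcs (G x)} \<union> (SIGMA y:{y. (x, y) \<in> parcs H}. pverts (G y))"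
    using x u by (auto simp: hjoin_def)
  moreover have "card \<dots> = card (Pair x ` {v. (u, v) \<in> parcs (G x)})
      + card (SIGMA y:{y. (x, y) \<in> parcs H}. pverts (G y))"
    using pair_graphD(4)[OF H] nb finH finG finu by (intro card_Un_disjoint finite_SigmaI) auto
  moreover have "card (SIGMA y:{y. (x, y) \<in> parcs H}. pverts (G y)) = (\<Sum>y | (x, y) \<in> parcs H. card (pverts (G y)))"
    using nb finH finG by (intro card_SigmaI) auto
  ultimately show ?thesis
    by (simp add: out_degree_eq_card card_image inj_on_def)
qed

text \<open>The shift by \<open>t * w x\<close> arises here: degrees in the part of \<open>x\<close>
  grow by \<open>w x\<close>, and the matrix subtracts \<open>t\<close> times the degree. Off the
  diagonal, arcs inside a part and arcs coming from \<open>H\<close> exclude each other because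
  \<open>H\<close> is loop-free.\<close>

lemma hjoin_entry:
  fixes H :: "'h pair_pre_digraph" and G :: "'h \<Rightarrow> 'a pair_pre_digraph" and t :: real
  assumes H: "pair_graph H" and G: "\<And>x. x \<in> pverts H \<Longrightarrow> pair_graph (G x)"
    and p: "p \<in> pverts (hjoin H G)" and q: "q \<in> pverts (hjoin H G)"
  defines "w \<equiv> \<lambda>x. \<Sum>y | (x, y) \<in> parcs H. card (pverts (G y))"
  shows "(if p = q then to_fract [:0, 1:] else 0) - fract_const (graph_entry t (hjoin H G) p q)
       = (if fst p = fst q
          then (if snd p = snd q then to_fract [:t * real (w (fst p)), 1:] else 0)
             - fract_const (graph_entry t (G (fst p)) (snd p) (snd q)) else 0)
         - (if (fst p, fst q) \<in> parcs H then 1 else 0)"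
proof -
  obtain x u y v where [simp]: "p = (x, u)" "q = (y, v)" by (cases p, cases q)
  have x: "x \<in> pverts H" "u \<in> pverts (G x)" and y: "y \<in> pverts H" "v \<in> pverts (G y)"
    using p q by (auto simp: hjoin_def)
  have noloop: "(x, x) \<notin> parcs H" "(u, u) \<notin> parcs (G x)"
    using pair_graphD(4)[OF H, of x x] pair_graphD(4)[OF G[OF x(1)], of u u] by auto
  show ?thesis
  proof (cases "p = q")
    case True
    then have "y = x" "v = u" by simp_all
    moreover have "(p, p) \<notin> parcs (hjoin H G)"
      using noloop by (auto simp: hjoin_def)
    ultimately show ?thesis
      using noloop out_degree_hjoin[where G = G, OF H G x]
      by (simp add: graph_entry_def algebra_simps w_def flip: to_fract_diff to_fract_add)
  next
    case False
    have "(p, q) \<in> parcs (hjoin H G) \<longleftrightarrow> (x = y \<and> (u, v) \<in> parcs (G x)) \<or> (x, y) \<in> parcs H"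
      using x y by (auto simp: hjoin_def)
    then show ?thesis
      using noloop False by (auto simp: graph_entry_def pCons_one)
  qed
qed

text \<open>\<open>det_join\<close> is applied to the entries found above. Keeping the main function
  as a factor, rather than dividing by it, gives a common form from which row scaling yields both
  \<open>Mtilde\<close> and \<open>\<Phi>mat\<close>.\<close>

lemma char_poly_hjoin:
  fixes H :: "'h pair_pre_digraph" and G :: "'h \<Rightarrow> 'a pair_pre_digraph" and t :: real
    and vs :: "'h list" and us :: "'h \<Rightarrow> 'a list" and ws :: "('h \<times> 'a) list"
  assumes H: "pair_graph H" and G: "\<And>x. x \<in> pverts H \<Longrightarrow> pair_graph (G x)"
    and vs: "enumerates vs (pverts H)"
    and us: "\<And>x. x \<in> pverts H \<Longrightarrow> enumerates (us x) (pverts (G x))"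
    and ws: "enumerates ws (pverts (hjoin H G))"
  defines "M \<equiv> \<lambda>x. adj_deg_matrix t (G x) (us x)"
    and "s \<equiv> \<lambda>x. [:t * real (\<Sum>y | (x, y) \<in> parcs H. card (pverts (G y))), 1:]"
  shows "to_fract (char_poly (adj_deg_matrix t (hjoin H G) ws))
       = (\<Prod>x\<in>pverts H. to_fract (char_poly (M x) \<circ>\<^sub>p s x))
         * det (fun_mat vs vs (\<lambda>x y. (if x = y then 1 else 0)
             - main_function (M x) (to_fract (s x)) * (if (x, y) \<in> parcs H then 1 else 0)))"
proof -
  let ?B = "\<lambda>x u v. (if u = v then to_fract (s x) else 0) - fract_const (graph_entry t (G x) u v)"
  have vs': "distinct vs" "set vs = pverts H" using vs by (auto simp: enumerates_def)
  have ws': "distinct ws" "set ws = pverts (hjoin H G)" using ws by (auto simp: enumerates_def)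
  have us': "distinct (us x)" "set (us x) = pverts (G x)" if "x \<in> pverts H" for x
    using us[OF that] by (auto simp: enumerates_def)
  have M: "M x = fun_mat (us x) (us x) (graph_entry t (G x))" if "x \<in> pverts H" for x
    unfolding M_def by (rule adj_deg_matrix_eq_fun_mat[OF us'(1)[OF that]])
  have "\<forall>x\<in>pverts H. \<exists>c. (\<forall>u\<in>set (us x). (\<Sum>v\<in>set (us x). ?B x u v * c v) = 1) \<and>
      main_function (M x) (to_fract (s x)) = (\<Sum>u\<in>set (us x). c u)"
  proof
    fix x assume x: "x \<in> pverts H"
    have "transpose_mat (M x) = M x"
      unfolding M_def by (rule transpose_adj_deg_matrix[OF G[OF x]])
    then show "\<exists>c. (\<forall>u\<in>set (us x). (\<Sum>v\<in>set (us x). ?B x u v * c v) = 1) \<and>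
        main_function (M x) (to_fract (s x)) = (\<Sum>u\<in>set (us x). c u)"
      unfolding s_def by (rule main_function_linear_system[OF us'(1)[OF x] M[OF x]])
  qed
  from bchoice[OF this] obtain c where c: "\<forall>x\<in>pverts H.
      (\<forall>u\<in>set (us x). (\<Sum>v\<in>set (us x). ?B x u v * c x v) = 1) \<and>
      main_function (M x) (to_fract (s x)) = (\<Sum>u\<in>set (us x). c x u)"
    by (rule exE)
  have join_mat: "to_fract [:0, 1:] \<cdot>\<^sub>m 1\<^sub>m (length ws) - map_mat fract_const (adj_deg_matrix t (hjoin H G) ws)
      = fun_mat ws ws (\<lambda>p q. (if p = q then to_fract [:0, 1:] else 0) - fract_const (graph_entry t (hjoin H G) p q))"
    unfolding adj_deg_matrix_eq_fun_mat[OF ws'(1)] using ws'(1)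
    by (intro eq_matI) (auto simp: nth_eq_iff_index_eq)
  have "adj_deg_matrix t (hjoin H G) ws \<in> carrier_mat (length ws) (length ws)"
    unfolding adj_deg_matrix_eq_fun_mat[OF ws'(1)] by simp
  \<comment> \<open>Substituting the indeterminate for itself leaves the characteristic polynomial
    unchanged.\<close>
  from to_fract_char_poly_pcompose[OF this, of "[:0, 1:]"]
  have "to_fract (char_poly (adj_deg_matrix t (hjoin H G) ws)) = det (fun_mat ws ws
      (\<lambda>p q. (if p = q then to_fract [:0, 1:] else 0) - fract_const (graph_entry t (hjoin H G) p q)))"
    by (simp only: pcompose_idR join_mat)
  also have "\<dots> = det (fun_mat ws ws (\<lambda>p q. (if fst p = fst q then ?B (fst p) (snd p) (snd q) else 0)
      - (if (fst p, fst q) \<in> parcs H then 1 else 0)))"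
    by (intro arg_cong[of _ _ det] fun_mat_cong) (simp only: ws'(2) s_def hjoin_entry[where G = G, OF H G])
  also have "\<dots> = (\<Prod>x\<in>set vs. det (fun_mat (us x) (us x) (?B x)))
      * det (fun_mat vs vs (\<lambda>x y. (if x = y then 1 else 0)
          - (\<Sum>u\<in>set (us x). c x u) * (if (x, y) \<in> parcs H then 1 else 0)))"
    using c us' by (intro det_join[where R = "\<lambda>x y. if (x, y) \<in> parcs H then 1 else 0"] vs'(1) ws'(1))
      (auto simp: vs'(2) ws'(2) hjoin_def)
  also have "(\<Prod>x\<in>set vs. det (fun_mat (us x) (us x) (?B x)))
      = (\<Prod>x\<in>pverts H. to_fract (char_poly (M x) \<circ>\<^sub>p s x))"
    unfolding vs'(2)
  proof (intro prod.cong refl)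
    fix x assume x: "x \<in> pverts H"
    have "M x \<in> carrier_mat (length (us x)) (length (us x))" unfolding M[OF x] by simp
    from to_fract_char_poly_pcompose[OF this]
    have "to_fract (char_poly (M x) \<circ>\<^sub>p s x)
        = det (to_fract (s x) \<cdot>\<^sub>m 1\<^sub>m (length (us x)) - map_mat fract_const (M x))" .
    also have "to_fract (s x) \<cdot>\<^sub>m 1\<^sub>m (length (us x)) - map_mat fract_const (M x) = fun_mat (us x) (us x) (?B x)"
      unfolding M[OF x] using us'(1)[OF x] by (intro eq_matI) (auto simp: nth_eq_iff_index_eq)
    finally show "det (fun_mat (us x) (us x) (?B x)) = to_fract (char_poly (M x) \<circ>\<^sub>p s x)" by simp
  qed
  also have "fun_mat vs vs (\<lambda>x y. (if x = y then 1 else 0)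
          - (\<Sum>u\<in>set (us x). c x u) * (if (x, y) \<in> parcs H then 1 else 0))
      = fun_mat vs vs (\<lambda>x y. (if x = y then 1 else 0)
          - main_function (M x) (to_fract (s x)) * (if (x, y) \<in> parcs H then 1 else 0))"
    using c by (intro fun_mat_cong) (simp add: vs'(2))
  finally show ?thesis .
qed

section \<open>Linear factors and multiplicities in the spectrum\<close>

lemma proots_complex_prod_linear_powers:
  "proots (map_poly complex_of_real (\<Prod>\<mu>\<in>S. ([:b, 1:] - [:\<mu>:]) ^ m \<mu>))
     = (\<Sum>\<mu>\<in>S. replicate_mset (m \<mu>) (complex_of_real (\<mu> - b)))"
proof -
  interpret complex_poly_hom: map_poly_inj_idom_hom complex_of_real ..
  have "map_poly complex_of_real (\<Prod>\<mu>\<in>S. ([:b, 1:] - [:\<mu>:]) ^ m \<mu>)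
      = (\<Prod>\<mu>\<in>S. [:complex_of_real (b - \<mu>), 1:] ^ m \<mu>)"
    by (simp add: complex_poly_hom.hom_prod complex_poly_hom.hom_power)
  also have "proots \<dots> = (\<Sum>\<mu>\<in>S. proots ([:complex_of_real (b - \<mu>), 1:] ^ m \<mu>))"
    by (rule proots_prod) simp
  also have "\<dots> = (\<Sum>\<mu>\<in>S. replicate_mset (m \<mu>) (complex_of_real (\<mu> - b)))"
    by (simp add: proots_power)
  finally show ?thesis .
qed

text \<open>One linear factor is set aside for each main eigenvalue; these form \<open>g\<close>,
  which clears the poles of the main function. The remaining factors account for the eigenvalues
  listed explicitly, hence the multiplicity lowered by one.\<close>

lemma char_poly_pcompose_factorization:
  fixes A :: "real mat"
  assumes A: "A \<in> carrier_mat n n" and sym: "transpose_mat A = A"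
  shows "char_poly A \<circ>\<^sub>p [:b, 1:]
       = (\<Prod>\<mu> | eigenvalue A \<mu> \<and> \<not> main_eigenvalue A \<mu>. ([:b, 1:] - [:\<mu>:]) ^ eig_mult A \<mu>)
         * (\<Prod>\<mu> | main_eigenvalue A \<mu>. ([:b, 1:] - [:\<mu>:]) ^ (eig_mult A \<mu> - 1))
         * (\<Prod>\<mu> | main_eigenvalue A \<mu>. [:b, 1:] - [:\<mu>:])"
proof -
  let ?l = "\<lambda>\<mu>. [:b, 1:] - [:\<mu>:]"
  have main: "eigenvalue A \<mu>" if "main_eigenvalue A \<mu>" for \<mu>
    using that by (simp add: main_eigenvalue_def)
  have fin: "finite {\<mu>. eigenvalue A \<mu>}" by (rule finite_eigenvalues[OF A])
  have pos: "eig_mult A \<mu> > 0" if "eigenvalue A \<mu>" for \<mu>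
  proof -
    have "char_poly A \<noteq> 0" using degree_monic_char_poly[OF A] by auto
    then show ?thesis
      using that by (simp add: eig_mult_def eigenvalue_root_char_poly[OF A] order_gt_0_iff)
  qed
  have "char_poly A \<circ>\<^sub>p [:b, 1:] = (\<Prod>\<mu> | eigenvalue A \<mu>. [:-\<mu>, 1:] ^ eig_mult A \<mu>) \<circ>\<^sub>p [:b, 1:]"
    using real_symmetric_char_poly_factorization[OF A sym] by simp
  also have "\<dots> = (\<Prod>\<mu> | eigenvalue A \<mu>. ?l \<mu> ^ eig_mult A \<mu>)"
    unfolding pcompose_prod pcompose_hom.hom_power by (simp add: pcompose_pCons)
  also have "{\<mu>. eigenvalue A \<mu>}
      = {\<mu>. eigenvalue A \<mu> \<and> \<not> main_eigenvalue A \<mu>} \<union> {\<mu>. main_eigenvalue A \<mu>}"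
    using main by blast
  also have "(\<Prod>\<mu>\<in>\<dots>. ?l \<mu> ^ eig_mult A \<mu>)
      = (\<Prod>\<mu> | eigenvalue A \<mu> \<and> \<not> main_eigenvalue A \<mu>. ?l \<mu> ^ eig_mult A \<mu>)
        * (\<Prod>\<mu> | main_eigenvalue A \<mu>. ?l \<mu> ^ eig_mult A \<mu>)"
    by (rule prod.union_disjoint) (use main in \<open>auto intro: finite_subset[OF _ fin]\<close>)
  also have "(\<Prod>\<mu> | main_eigenvalue A \<mu>. ?l \<mu> ^ eig_mult A \<mu>)
      = (\<Prod>\<mu> | main_eigenvalue A \<mu>. ?l \<mu> ^ (eig_mult A \<mu> - 1) * ?l \<mu>)"
  proof (intro prod.cong refl)
    fix \<mu> assume "\<mu> \<in> {\<mu>. main_eigenvalue A \<mu>}"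
    \<comment> \<open>Positivity of the multiplicity makes the truncated subtraction of 1 a genuine
      one.\<close>
    then have "eig_mult A \<mu> > 0" using pos main by blast
    then show "?l \<mu> ^ eig_mult A \<mu> = ?l \<mu> ^ (eig_mult A \<mu> - 1) * ?l \<mu>"
      by (simp only: power_minus_mult)
  qed
  finally show ?thesis by (simp only: prod.distrib mult.assoc)
qed

theorem theorem4p7:
  fixes H :: "'h pair_pre_digraph"
    and G :: "'h \<Rightarrow> 'a pair_pre_digraph"
    and t :: real
    and vs :: "'h list"
    and us :: "'h \<Rightarrow> 'a list"
    and ws :: "('h \<times> 'a) list"
    and k :: nat
    and M :: "'h \<Rightarrow> real mat"
    and w :: "'h \<Rightarrow> nat"
    and \<rho> :: "'h \<Rightarrow> 'h \<Rightarrow> real poly fract"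
    and s :: "'h \<Rightarrow> real poly"
    and \<Gamma> g f :: "'h \<Rightarrow> real poly fract"
    and Mtilde \<Phi>mat :: "real poly fract mat"
  assumes "pair_graph H"
    and "\<And>x. x \<in> pverts H \<Longrightarrow> pair_graph (G x)"
    and "\<And>x. x \<in> pverts H \<Longrightarrow> pverts (G x) \<noteq> {}"
    and "enumerates vs (pverts H)"
    and "\<And>x. x \<in> pverts H \<Longrightarrow> enumerates (us x) (pverts (G x))"
    and "enumerates ws (pverts (hjoin H G))"
  defines "k \<equiv> length vs"
    and "M \<equiv> \<lambda>x. adj_deg_matrix t (G x) (us x)"
    and "w \<equiv> \<lambda>x. \<Sum>y | (x, y) \<in> parcs H. card (pverts (G y))"
    and "\<rho> \<equiv> \<lambda>x y. if (x, y) \<in> parcs H then 1 else 0"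
    \<comment> \<open>\<open>s x\<close> is the polynomial \<open>\<lambda> + t w\<^sub>x\<close>, and \<open>\<Gamma> x\<close> is \<open>\<Gamma>\<^sub>x(\<lambda> + t w\<^sub>x)\<close>\<close>
    and "s \<equiv> \<lambda>x. [:t * real (w x), 1:]"
    and "\<Gamma> \<equiv> \<lambda>x. main_function (M x) (to_fract (s x))"
    and "Mtilde \<equiv> mat k k (\<lambda>(i, j).
           if i = j then 1 / \<Gamma> (vs ! i) else - \<rho> (vs ! i) (vs ! j))"
    and "g \<equiv> \<lambda>x. to_fract (\<Prod>\<theta> | main_eigenvalue (M x) \<theta>. s x - [:\<theta>:])"
    and "f \<equiv> \<lambda>x. g x * \<Gamma> x"
    and "\<Phi>mat \<equiv> mat k k (\<lambda>(i, j).
           if i = j then g (vs ! i) else - (\<rho> (vs ! i) (vs ! j) * f (vs ! i)))"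
  shows
    "to_fract (char_poly (adj_deg_matrix t (hjoin H G) ws)) =
       (\<Prod>x\<in>pverts H. to_fract (char_poly (M x) \<circ>\<^sub>p s x) * \<Gamma> x) * det Mtilde
     \<and>
     (\<exists>\<Phi> :: real poly. to_fract \<Phi> = det \<Phi>mat \<and>
       spectrum_mset (adj_deg_matrix t (hjoin H G) ws) =
         (\<Sum>x\<in>pverts H. \<Sum>\<mu> | eigenvalue (M x) \<mu> \<and> \<not> main_eigenvalue (M x) \<mu>.
            replicate_mset (eig_mult (M x) \<mu>) (complex_of_real (\<mu> - t * real (w x))))
       + (\<Sum>x\<in>pverts H. \<Sum>\<mu> | main_eigenvalue (M x) \<mu>.
            replicate_mset (eig_mult (M x) \<mu> - 1) (complex_of_real (\<mu> - t * real (w x))))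
       + proots (map_poly complex_of_real \<Phi>))"
proof -
  have vs: "distinct vs" "set vs = pverts H" using assms(4) by (auto simp: enumerates_def)
  have finH: "finite (pverts H)" using vs by (metis List.finite_set)
  have no_loop: "\<rho> x x = 0" for x using pair_graphD(4)[OF assms(1), of x x] by (auto simp: \<rho>_def)
  have M: "M x \<in> carrier_mat (length (us x)) (length (us x))" for x
    unfolding M_def by (rule adj_deg_matrix_carrier)
  have sym: "transpose_mat (M x) = M x" if "x \<in> pverts H" for x
    unfolding M_def by (rule transpose_adj_deg_matrix[OF assms(2)[OF that]])
  have \<Gamma>_nz: "\<Gamma> x \<noteq> 0" if x: "x \<in> pverts H" for x
  proof -
    \<comment> \<open>A nonempty summand gives a matrix of positive size, so that
      \<open>1 / \<Gamma> x\<close> in \<open>Mtilde\<close> is a genuine inverse.\<close>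
    have "length (us x) > 0" using assms(3,5)[OF x] by (auto simp: enumerates_def)
    then show ?thesis unfolding \<Gamma>_def s_def by (rule main_function_nonzero[OF M sym[OF x]])
  qed
  define gp where "gp x = (\<Prod>\<theta> | main_eigenvalue (M x) \<theta>. s x - [:\<theta>:])" for x
  \<comment> \<open>\<open>q x\<close> is what remains of the shifted characteristic polynomial once
    the factors in \<open>gp x\<close> are removed.\<close>
  define q where "q x = (\<Prod>\<mu> | eigenvalue (M x) \<mu> \<and> \<not> main_eigenvalue (M x) \<mu>.
        (s x - [:\<mu>:]) ^ eig_mult (M x) \<mu>)
      * (\<Prod>\<mu> | main_eigenvalue (M x) \<mu>. (s x - [:\<mu>:]) ^ (eig_mult (M x) \<mu> - 1))" for x
  have fac: "char_poly (M x) \<circ>\<^sub>p s x = q x * gp x" if "x \<in> pverts H" for x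
    unfolding q_def gp_def s_def by (rule char_poly_pcompose_factorization[OF M sym[OF that]])
  have "\<forall>x\<in>pverts H. \<exists>p. to_fract p = f x"
    unfolding f_def g_def \<Gamma>_def s_def
    using main_function_clear_denominators[OF M sym] by blast
  from bchoice[OF this] obtain fp where fp: "\<And>x. x \<in> pverts H \<Longrightarrow> to_fract (fp x) = f x" by blast

  let ?MG = "adj_deg_matrix t (hjoin H G) ws"
  let ?D = "fun_mat vs vs (\<lambda>x y. (if x = y then 1 else 0) - \<Gamma> x * \<rho> x y)"
  have cp: "to_fract (char_poly ?MG) = (\<Prod>x\<in>pverts H. to_fract (char_poly (M x) \<circ>\<^sub>p s x)) * det ?D"
    unfolding \<Gamma>_def \<rho>_def s_def M_def w_def
    by (rule char_poly_hjoin[OF assms(1,2,4,5,6)])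
  have Mt: "Mtilde = fun_mat vs vs (\<lambda>x y. if x = y then 1 / \<Gamma> x else - \<rho> x y)"
    unfolding Mtilde_def k_def using vs(1) by (intro eq_matI) (auto simp: nth_eq_iff_index_eq)
  \<comment> \<open>On the diagonal \<open>\<rho> x x = 0\<close> leaves 1, which is
    \<open>\<Gamma> x * (1 / \<Gamma> x)\<close>.\<close>
  have "?D = fun_mat vs vs (\<lambda>x y. \<Gamma> x * (if x = y then 1 / \<Gamma> x else - \<rho> x y))"
    using \<Gamma>_nz by (intro fun_mat_cong) (auto simp: vs(2) no_loop)
  then have D_\<Gamma>: "det ?D = (\<Prod>x\<in>pverts H. \<Gamma> x) * det Mtilde"
    unfolding Mt by (simp only: det_fun_mat_scale_rows[OF vs(1)] vs(2))
  have part1: "to_fract (char_poly ?MG) =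
      (\<Prod>x\<in>pverts H. to_fract (char_poly (M x) \<circ>\<^sub>p s x) * \<Gamma> x) * det Mtilde"
    unfolding cp D_\<Gamma> by (simp only: prod.distrib mult.assoc)

  have "\<Phi>mat = fun_mat vs vs (\<lambda>x y. g x * ((if x = y then 1 else 0) - \<Gamma> x * \<rho> x y))"
    unfolding \<Phi>mat_def k_def f_def using vs(1)
    by (intro eq_matI) (auto simp: nth_eq_iff_index_eq no_loop)
  then have D_\<Phi>: "det \<Phi>mat = (\<Prod>x\<in>pverts H. g x) * det ?D"
    by (simp only: det_fun_mat_scale_rows[OF vs(1)] vs(2))
  \<comment> \<open>All entries of \<open>\<Phi>mat\<close> come from polynomials, namely
    \<open>gp\<close> and the cleared functions \<open>fp\<close>. Taking the determinant over
    polynomials and embedding it into the fractions gives \<open>det \<Phi>mat\<close>.\<close>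
  define \<Phi> where "\<Phi> = det (fun_mat vs vs
      (\<lambda>x y. if x = y then gp x else - (if (x, y) \<in> parcs H then fp x else 0)))"
  have "map_mat to_fract (fun_mat vs vs (\<lambda>x y. if x = y then gp x else - (if (x, y) \<in> parcs H then fp x else 0)))
      = \<Phi>mat"
    unfolding \<Phi>mat_def k_def using vs nth_mem[of _ vs]
    by (intro eq_matI) (auto simp: nth_eq_iff_index_eq g_def gp_def \<rho>_def fp)
  then have \<Phi>: "to_fract \<Phi> = det \<Phi>mat"
    unfolding \<Phi>_def by (simp only: fract.hom_det[symmetric])
  \<comment> \<open>The factors \<open>g x\<close> set aside in the characteristic polynomials turn
    \<open>det ?D\<close> into \<open>det \<Phi>mat\<close>, so the identity descends from fractions
    to polynomials.\<close>
  have "to_fract (char_poly ?MG) = (\<Prod>x\<in>pverts H. to_fract (q x) * g x) * det ?D"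
    unfolding cp by (simp add: fac g_def gp_def)
  also have "\<dots> = to_fract ((\<Prod>x\<in>pverts H. q x) * \<Phi>)"
    by (simp only: prod.distrib mult.assoc D_\<Phi> \<Phi> to_fract_mult fract.hom_prod)
  finally have char: "char_poly ?MG = (\<Prod>x\<in>pverts H. q x) * \<Phi>"
    by (simp only: to_fract_eq_iff)

  interpret complex_poly_hom: map_poly_inj_idom_hom complex_of_real ..
  have MG: "?MG \<in> carrier_mat (length ws) (length ws)"
    by (rule adj_deg_matrix_carrier)
  \<comment> \<open>A monic polynomial is nonzero, hence so is each of its factors;
    \<open>proots\<close> turns products into sums under this condition.\<close>
  have "char_poly ?MG \<noteq> 0" using degree_monic_char_poly[OF MG] by auto
  then have nz: "\<And>x. x \<in> pverts H \<Longrightarrow> q x \<noteq> 0" "\<Phi> \<noteq> 0"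
    using finH by (auto simp: char)
  let ?nonmain = "\<lambda>x. \<Sum>\<mu> | eigenvalue (M x) \<mu> \<and> \<not> main_eigenvalue (M x) \<mu>.
      replicate_mset (eig_mult (M x) \<mu>) (complex_of_real (\<mu> - t * real (w x)))"
  let ?main = "\<lambda>x. \<Sum>\<mu> | main_eigenvalue (M x) \<mu>.
      replicate_mset (eig_mult (M x) \<mu> - 1) (complex_of_real (\<mu> - t * real (w x)))"
  have q: "proots (map_poly complex_of_real (q x)) = ?nonmain x + ?main x" if "x \<in> pverts H" for x
  proof -
    have "q x \<noteq> 0" by (rule nz(1)[OF that])
    then show ?thesis
      unfolding q_def complex_poly_hom.hom_mult s_def
      by (subst proots_mult) (auto simp only: mult_eq_0_iff complex_poly_hom.hom_0_iff
          proots_complex_prod_linear_powers)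
  qed
  have "spectrum_mset ?MG = proots (map_poly complex_of_real (char_poly ?MG))"
    unfolding spectrum_mset_def by (simp only: of_real_hom.char_poly_hom[OF MG])
  also have "\<dots> = proots (\<Prod>x\<in>pverts H. map_poly complex_of_real (q x))
      + proots (map_poly complex_of_real \<Phi>)"
    unfolding char complex_poly_hom.hom_mult complex_poly_hom.hom_prod
    using nz finH by (intro proots_mult) auto
  also have "proots (\<Prod>x\<in>pverts H. map_poly complex_of_real (q x))
      = (\<Sum>x\<in>pverts H. ?nonmain x + ?main x)"
    using nz by (subst proots_prod) (auto simp: q)
  also have "\<dots> = (\<Sum>x\<in>pverts H. ?nonmain x) + (\<Sum>x\<in>pverts H. ?main x)"
    by (rule sum.distrib)
  finally have "spectrum_mset ?MG = (\<Sum>x\<in>pverts H. ?nonmain x) + (\<Sum>x\<in>pverts H. ?main x)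
      + proots (map_poly complex_of_real \<Phi>)" .
  with part1 \<Phi> show ?thesis by blast
qed

end
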